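(* For an arbitrary subset $A\subset\mathbb{R}$, the following statements are equivalent: (1) $(\mathbb{R},\tau_A)$ is metrizable; (2) $(\mathbb{R},\tau_A)$ is a $\beta$-space; (3) $\mathbb{R}\setminus A$ is countable.
   Context: For $A\subset\mathbb{R}$, $\tau_A$ is the topology on $\mathbb{R}$ in which each $x\in A$ has neighborhood base $\{(x-\varepsilon,x+\varepsilon):\varepsilon>0\}$ and each $x\in\mathbb{R}\setminus A$ has neighborhood base $\{[x,x+\varepsilon):\varepsilon>0\}$. A space $(X,\tau)$ is a $\beta$-space if there is a function $g:\omega\times X\to\tau$ with $x\in g(n,x)$ for all $n\in\omega$, $x\in X$, such that whenever $x\in X$ and $(x_n)_{n\in\omega}$ is a sequence in $X$ with $x\in g(n,x_n)$ for every $n\in\omega$, the sequence $(x_n)$ has a cluster point in $X$. *)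

theory Defs
  imports "HOL-Analysis.Analysis"
begin

definition hattori_nbhd :: "real set \<Rightarrow> real \<Rightarrow> real \<Rightarrow> real set" where
  "hattori_nbhd A x e = (if x \<in> A then {x - e<..<x + e} else {x..<x + e})"

text \<open>A set is open iff it contains a basic neighbourhood of each of its points.  The lemmas
  \<open>openin_hattori_nbhd\<close> and \<open>openin_hattori\<close> below confirm that the basic neighbourhoods of \<open>x\<close>
  are open and form a neighbourhood base at \<open>x\<close>.\<close>

definition hattori_topology :: "real set \<Rightarrow> real topology" where
  "hattori_topology A = topology (\<lambda>U. \<forall>x\<in>U. \<exists>e>0. hattori_nbhd A x e \<subseteq> U)"

lemma hattori_nbhd_mono: "d \<le> e \<Longrightarrow> hattori_nbhd A x d \<subseteq> hattori_nbhd A x e"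
  by (auto simp: hattori_nbhd_def)

lemma hattori_nbhd_self: "0 < e \<Longrightarrow> x \<in> hattori_nbhd A x e"
  by (auto simp: hattori_nbhd_def)

lemma istopology_hattori: "istopology (\<lambda>U. \<forall>x\<in>U. \<exists>e>0. hattori_nbhd A x e \<subseteq> U)"
  unfolding istopology_def
proof (intro conjI allI impI ballI)
  fix S T x
  assume S: "\<forall>x\<in>S. \<exists>e>0. hattori_nbhd A x e \<subseteq> S"
    and T: "\<forall>x\<in>T. \<exists>e>0. hattori_nbhd A x e \<subseteq> T" and x: "x \<in> S \<inter> T"
  obtain d e where "d > 0" "hattori_nbhd A x d \<subseteq> S" "e > 0" "hattori_nbhd A x e \<subseteq> T"
    using S T x by blast
  then show "\<exists>e>0. hattori_nbhd A x e \<subseteq> S \<inter> T"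
    using hattori_nbhd_mono[of "min d e" d A x] hattori_nbhd_mono[of "min d e" e A x]
    by (intro exI[of _ "min d e"]) auto
next
  fix K x
  assume K: "\<forall>S\<in>K. \<forall>x\<in>S. \<exists>e>0. hattori_nbhd A x e \<subseteq> S" and "x \<in> \<Union> K"
  then obtain S where "S \<in> K" "x \<in> S" by blast
  with K obtain e where "e > 0" "hattori_nbhd A x e \<subseteq> S" by blast
  with \<open>S \<in> K\<close> show "\<exists>e>0. hattori_nbhd A x e \<subseteq> \<Union> K" by blast
qed

lemma openin_hattori:
  "openin (hattori_topology A) U \<longleftrightarrow> (\<forall>x\<in>U. \<exists>e>0. hattori_nbhd A x e \<subseteq> U)"
  unfolding hattori_topology_def by (simp add: topology_inverse' istopology_hattori)

lemma topspace_hattori [simp]: "topspace (hattori_topology A) = UNIV"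
proof -
  have "openin (hattori_topology A) UNIV"
    by (auto simp: openin_hattori intro: exI[of _ 1])
  then show ?thesis
    using openin_subset by blast
qed

lemma openin_hattori_nbhd: "openin (hattori_topology A) (hattori_nbhd A x e)"
  unfolding openin_hattori
proof
  fix y assume y: "y \<in> hattori_nbhd A x e"
  show "\<exists>d>0. hattori_nbhd A y d \<subseteq> hattori_nbhd A x e"
  proof (cases "x = y")
    case True
    with y have "e > 0" by (auto simp: hattori_nbhd_def split: if_splits)
    with True show ?thesis by blast
  next
    case False
    with y have "min \<bar>y - x\<bar> (e - \<bar>y - x\<bar>) > 0"
      by (auto simp: hattori_nbhd_def split: if_splits)
    moreover have "hattori_nbhd A y (min \<bar>y - x\<bar> (e - \<bar>y - x\<bar>)) \<subseteq> hattori_nbhd A x e"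
      using y by (auto simp: hattori_nbhd_def min_def abs_if split: if_splits)
    ultimately show ?thesis by blast
  qed
qed

definition seq_cluster_point :: "'a topology \<Rightarrow> (nat \<Rightarrow> 'a) \<Rightarrow> 'a \<Rightarrow> bool" where
  "seq_cluster_point X s p \<longleftrightarrow> p \<in> topspace X \<and>
     (\<forall>U. openin X U \<longrightarrow> p \<in> U \<longrightarrow> (\<exists>\<^sub>F n in sequentially. s n \<in> U))"

definition beta_space :: "'a topology \<Rightarrow> bool" where
  "beta_space X \<longleftrightarrow> (\<exists>g :: nat \<Rightarrow> 'a \<Rightarrow> 'a set.
     (\<forall>n. \<forall>x\<in>topspace X. openin X (g n x) \<and> x \<in> g n x) \<and>
     (\<forall>x\<in>topspace X. \<forall>s. range s \<subseteq> topspace X \<longrightarrow> (\<forall>n. x \<in> g n (s n)) \<longrightarrow>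
        (\<exists>p. seq_cluster_point X s p)))"

end

theory Submission
  imports Defs
begin

text \<open>If the complement \<open>B\<close> of \<open>A\<close> is countable, a strictly increasing function that jumps from the
  left exactly at the points of \<open>B\<close> and is right-continuous pulls the Euclidean metric back to one
  inducing \<open>\<tau>\<^sub>A\<close>.  If \<open>B\<close> is uncountable, then for every candidate \<open>g\<close> some \<open>x \<in> B\<close> admits
  points \<open>s n < x\<close> converging to \<open>x\<close> in the Euclidean sense with \<open>x \<in> g n (s n)\<close>; their only
  possible cluster point is \<open>x\<close>, which \<open>[x, x + 1)\<close> excludes.  Such an \<open>x\<close> exists: otherwise, for
  some \<open>n\<close> and \<open>\<epsilon> > 0\<close>, the points \<open>x \<in> B\<close> lying in no \<open>g n y\<close> with \<open>x - \<epsilon> < y < x\<close> form an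
  uncountable set, which accumulates from the right at one of its points \<open>y\<close>, and the elements just
  to the right of \<open>y\<close> lie in \<open>g n y\<close>.\<close>

lemma metrizable_imp_beta_space:
  assumes "metrizable_space X"
  shows "beta_space X"
proof -
  obtain M d where M: "Metric_space M d" and X: "X = Metric_space.mtopology M d"
    using assms unfolding metrizable_space_def by blast
  interpret Metric_space M d by fact
  show ?thesis
    unfolding beta_space_def X topspace_mtopology
  \<comment> \<open>By symmetry of the metric, \<open>x\<close> in the ball about \<open>s n\<close>
    puts \<open>s n\<close> in the ball about \<open>x\<close>, so \<open>s\<close> converges to
    \<open>x\<close>.\<close>
  proof (intro exI[of _ "\<lambda>n x. mball x (inverse (Suc n))"] conjI allI ballI impI)
    fix x s assume x: "x \<in> M" and s: "range s \<subseteq> M" "\<forall>n. x \<in> mball (s n) (inverse (Suc n))"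
    have "seq_cluster_point mtopology s x"
      unfolding seq_cluster_point_def topspace_mtopology
    proof (intro conjI allI impI)
      fix U assume "openin mtopology U" "x \<in> U"
      then obtain r where r: "r > 0" "mball x r \<subseteq> U"
        unfolding openin_mtopology by blast
      have "eventually (\<lambda>n. inverse (real (Suc n)) < r) sequentially"
        using LIMSEQ_inverse_real_of_nat r(1) by (rule order_tendstoD)
      then have "eventually (\<lambda>n. s n \<in> U) sequentially"
      proof eventually_elim
        case (elim n)
        with s have "s n \<in> mball x r"
          using commute[of x "s n"] by (auto intro: less_trans)
        with r show ?case by blast
      qed
      then show "\<exists>\<^sub>F n in sequentially. s n \<in> U"
        by (simp add: eventually_frequently)
    qed (use x in auto)
    then show "\<exists>p. seq_cluster_point mtopology s p" ..
  qed auto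
qed

text \<open>Otherwise every point of \<open>C\<close> has a gap of \<open>C\<close> to its right. A
  rational \<open>q y\<close> chosen in the gap after \<open>y\<close> lies below all later points
  of \<open>C\<close>, so \<open>q\<close> embeds \<open>C\<close> in the rationals.\<close>

lemma uncountable_right_limit_point:
  fixes C :: "real set"
  assumes "uncountable C"
  obtains y where "y \<in> C" "\<And>e. e > 0 \<Longrightarrow> \<exists>x\<in>C. y < x \<and> x < y + e"
proof -
  have "\<not> (\<forall>y\<in>C. \<exists>e>0. \<forall>x\<in>C. \<not> (y < x \<and> x < y + e))"
  proof
    assume gap: "\<forall>y\<in>C. \<exists>e>0. \<forall>x\<in>C. \<not> (y < x \<and> x < y + e)"
    have "\<exists>q\<in>\<rat>. y < q \<and> (\<forall>x\<in>C. y < x \<longrightarrow> q < x)" if y: "y \<in> C" for y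
    proof -
      obtain e where e: "e > 0" "\<forall>x\<in>C. \<not> (y < x \<and> x < y + e)"
        using gap y by blast
      obtain q where "q \<in> \<rat>" "y < q" "q < y + e"
        using Rats_dense_in_real[of y "y + e"] e by auto
      moreover have "q < x" if "x \<in> C" "y < x" for x
        using e(2) that \<open>q < y + e\<close> by (metis less_le_trans not_le)
      ultimately show ?thesis by blast
    qed
    then have "\<forall>y\<in>C. \<exists>q. q \<in> \<rat> \<and> y < q \<and> (\<forall>x\<in>C. y < x \<longrightarrow> q < x)"
      by blast
    then obtain q where q: "\<forall>y\<in>C. q y \<in> \<rat> \<and> y < q y \<and> (\<forall>x\<in>C. y < x \<longrightarrow> q y < x)"
      by (rule bchoice[THEN exE])
    have "inj_on q C"
    proof (rule linorder_inj_onI')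
      fix x y assume "x \<in> C" "y \<in> C" "x < y"
      then have "q x < y" "y < q y" using q by blast+
      then show "q x \<noteq> q y" by simp
    qed
    moreover have "q ` C \<subseteq> \<rat>" using q by blast
    ultimately show False
      using assms countable_image_inj_on[of q C] countable_subset[OF _ countable_rat] by auto
  qed
  then obtain y where "y \<in> C" "\<forall>e>0. \<exists>x\<in>C. y < x \<and> x < y + e"
    by blast
  then show thesis by (intro that) auto
qed

lemma beta_hattori_imp_countable:
  assumes "beta_space (hattori_topology A)"
  shows "countable (UNIV - A)"
proof (rule ccontr)
  assume unc: "uncountable (UNIV - A)"
  obtain g where g: "\<And>n x. openin (hattori_topology A) (g n x)" "\<And>n x. x \<in> g n x"
    and cluster: "\<And>x s. (\<And>n. x \<in> g n (s n)) \<Longrightarrow> \<exists>p. seq_cluster_point (hattori_topology A) s p"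
    using assms unfolding beta_space_def by auto
  define C where "C n k = {x. x \<notin> A \<and> \<not> (\<exists>y. x - inverse (Suc k) < y \<and> y < x \<and> x \<in> g n y)}"
    for n k :: nat
  have count: "countable (C n k)" for n k
  proof (rule ccontr)
    assume "uncountable (C n k)"
    then obtain y where y: "y \<in> C n k" "\<And>e. e > 0 \<Longrightarrow> \<exists>x\<in>C n k. y < x \<and> x < y + e"
      using uncountable_right_limit_point by blast
    have "y \<notin> A" using y(1) by (simp add: C_def)
    then obtain e where e: "e > 0" "{y..<y + e} \<subseteq> g n y"
      using g(1)[of n y] g(2)[of y n] by (force simp: openin_hattori hattori_nbhd_def)
    \<comment> \<open>The bound \<open>e\<close> puts \<open>x\<close> into \<open>g n y\<close>;
      the other bound puts \<open>y\<close> into the window to the left of \<open>x\<close> that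
      \<open>C n k\<close> forbids.\<close>
    obtain x where "x \<in> C n k" "y < x" "x < y + min e (inverse (Suc k))"
      using y(2)[of "min e (inverse (Suc k))"] e(1) by auto
    then have "x - inverse (Suc k) < y" "x \<in> g n y"
      using e(2) by auto
    with \<open>x \<in> C n k\<close> \<open>y < x\<close> show False by (auto simp: C_def)
  qed
  have "countable (\<Union>n. \<Union>k. C n k)"
    by (intro countable_UN countableI_type count)
  then have "\<not> UNIV - A \<subseteq> (\<Union>n. \<Union>k. C n k)"
    using unc countable_subset by blast
  then obtain x where x: "x \<notin> A" "x \<notin> (\<Union>n. \<Union>k. C n k)"
    by (auto simp: subset_iff)
  \<comment> \<open>Taking \<open>k = n\<close> shrinks the windows with \<open>n\<close>, which
    forces \<open>s\<close> to converge to \<open>x\<close> from the left.\<close>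
  then have "\<forall>n. \<exists>y. x - inverse (Suc n) < y \<and> y < x \<and> x \<in> g n y"
    by (auto simp: C_def)
  then obtain s where s: "\<And>n. x - inverse (Suc n) < s n" "\<And>n. s n < x" "\<And>n. x \<in> g n (s n)"
    by metis
  obtain p where p: "\<And>U. openin (hattori_topology A) U \<Longrightarrow> p \<in> U \<Longrightarrow> \<exists>\<^sub>F n in sequentially. s n \<in> U"
    using cluster[of x s, OF s(3)] by (auto simp: seq_cluster_point_def)
  show False
  proof (cases "p < x")
    case True
    define r where "r = (x - p) / 2"
    have "r > 0" using True by (simp add: r_def)
    have "eventually (\<lambda>n. inverse (real (Suc n)) < r) sequentially"
      using LIMSEQ_inverse_real_of_nat \<open>r > 0\<close> by (rule order_tendstoD)
    then have "eventually (\<lambda>n. s n \<notin> hattori_nbhd A p r) sequentially"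
    proof eventually_elim
      case (elim n)
      have "p + r = x - r" by (simp add: r_def field_simps)
      then have "p + r < s n" using s(1)[of n] elim by linarith
      then show ?case by (auto simp: hattori_nbhd_def)
    qed
    moreover have "\<exists>\<^sub>F n in sequentially. s n \<in> hattori_nbhd A p r"
      by (rule p[OF openin_hattori_nbhd hattori_nbhd_self[OF \<open>r > 0\<close>]])
    ultimately show False by (simp add: frequently_def)
  next
    case False
    \<comment> \<open>Either radius keeps the neighbourhood of \<open>p\<close> within
      \<open>{x..}\<close>, while \<open>s n < x\<close>; for \<open>p = x\<close> this rests on
      \<open>x \<notin> A\<close>.\<close>
    define r where "r = (if p = x then 1 else p - x)"
    have "r > 0" using False by (simp add: r_def)
    then have "\<exists>\<^sub>F n in sequentially. s n \<in> hattori_nbhd A p r"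
      by (intro p openin_hattori_nbhd hattori_nbhd_self)
    moreover have "s n \<notin> hattori_nbhd A p r" for n
      using s(2)[of n] x False by (auto simp: hattori_nbhd_def r_def)
    ultimately show False by simp
  qed
qed

lemma countable_imp_metrizable_hattori:
  assumes "countable (UNIV - A)"
  shows "metrizable_space (hattori_topology A)"
proof -
  define b where "b = from_nat_into (UNIV - A)"
  \<comment> \<open>The enumeration may repeat points, which only enlarges the jumps. The guard
    \<open>b n \<notin> A\<close> covers an empty complement, where \<open>b n\<close> is an
    arbitrary real. The non-strict \<open>b n \<le> x\<close> makes the jumps
    right-continuous.\<close>
  define t :: "real \<Rightarrow> nat \<Rightarrow> real"
    where "t x n = (if b n \<notin> A \<and> b n \<le> x then (1/2)^n else 0)" for x n
  define f where "f x = x + suminf (t x)" for x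
  have geo: "summable (\<lambda>n. (1/2::real)^n)" by simp
  have sm: "summable (t x)" for x
    by (rule summable_comparison_test'[OF geo]) (auto simp: t_def)
  have mono_t: "t x n \<le> t y n" if "x \<le> y" for x y n
    using that by (auto simp: t_def)
  \<comment> \<open>Hence the pulled-back metric dominates the Euclidean one.\<close>
  have expand: "y - x \<le> f y - f x" if "x \<le> y" for x y
    using suminf_le[OF mono_t[OF that] sm sm] by (simp add: f_def)
  have jump: "\<exists>r>0. \<forall>y<x. r \<le> f x - f y" if x: "x \<notin> A" for x
  proof -
    obtain n where n: "b n = x"
      using from_nat_into_surj[OF assms] x unfolding b_def by blast
    have "(1/2)^n \<le> f x - f y" if "y < x" for y
    proof -
      have "t x n - t y n \<le> (\<Sum>k. t x k - t y k)"
        using mono_t[of y x] that sum_le_suminf[OF summable_diff[OF sm sm], of "{n}" x y] by simp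
      moreover have "t x n - t y n = (1/2)^n"
        using n x that by (simp add: t_def)
      ultimately show ?thesis
        using that by (simp add: f_def suminf_diff[OF sm sm, symmetric])
    qed
    then show ?thesis by (intro exI[of _ "(1/2)^n"]) auto
  qed
  \<comment> \<open>Each term \<open>t y n\<close> is constant for \<open>y\<close> in
    \<open>S\<close> near \<open>x\<close>: a jump at \<open>x\<close> itself is ruled out by
    \<open>x \<in> A\<close> or is invisible from the right. The geometric majorant lets the limit
    pass through the sum.\<close>
  have tendsto: "(f \<longlongrightarrow> f x) (at x within S)" if S: "x \<in> A \<or> S \<subseteq> {x..}" for x S
  proof (cases "at x within S = bot")
    case False
    have "((\<lambda>y. t y n) \<longlongrightarrow> t x n) (at x within S)" for n
    proof (rule tendsto_eventually, cases "b n = x")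
      case True
      with S show "eventually (\<lambda>y. t y n = t x n) (at x within S)"
        by (auto simp: t_def eventually_at intro!: exI[of _ 1])
    next
      case False
      then show "eventually (\<lambda>y. t y n = t x n) (at x within S)"
        by (auto simp: t_def eventually_at dist_real_def intro!: exI[of _ "\<bar>b n - x\<bar>"])
    qed
    moreover have "eventually (\<lambda>(n, y). norm (t y n) \<le> (1/2)^n) (at_top \<times>\<^sub>F (at x within S))"
      by (intro always_eventually) (auto simp: t_def)
    ultimately have "((\<lambda>y. suminf (t y)) \<longlongrightarrow> suminf (t x)) (at x within S)"
      using tannerys_theorem[of "\<lambda>n y. t y n" "t x" "at x within S" "\<lambda>n. (1/2)^n"] False geo
      by blast
    then show ?thesis
      unfolding f_def by (intro tendsto_intros)
  qed simp
  define d where "d x y = \<bar>f x - f y\<bar>" for x y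
  have inj: "f x = f y \<Longrightarrow> x = y" for x y
    using expand[of x y] expand[of y x] by linarith
  interpret Metric_space UNIV d
    by unfold_locales (auto simp: d_def dest: inj)
  have sub_nbhd: "\<exists>r>0. mball x r \<subseteq> hattori_nbhd A x e" if "e > 0" for x e
  proof (cases "x \<in> A")
    case True
    have "mball x e \<subseteq> hattori_nbhd A x e"
    proof
      fix y assume "y \<in> mball x e"
      then have "\<bar>x - y\<bar> < e"
        using expand[of x y] expand[of y x] unfolding in_mball d_def by arith
      then show "y \<in> hattori_nbhd A x e"
        using True by (auto simp: hattori_nbhd_def)
    qed
    with \<open>e > 0\<close> show ?thesis by blast
  next
    case False
    then obtain r where r: "r > 0" "\<And>y. y < x \<Longrightarrow> r \<le> f x - f y" using jump by blast
    \<comment> \<open>Radius \<open>r\<close> excludes \<open>y < x\<close> by the jump; for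
      \<open>y \<ge> x\<close>, \<open>expand\<close> gives \<open>y < x + e\<close>.\<close>
    have "mball x (min e r) \<subseteq> hattori_nbhd A x e"
    proof
      fix y assume "y \<in> mball x (min e r)"
      then have "\<not> y < x" "y < x + e"
        using expand[of x y] r(2)[of y] \<open>e > 0\<close> unfolding in_mball d_def by arith+
      then show "y \<in> hattori_nbhd A x e"
        using False by (auto simp: hattori_nbhd_def)
    qed
    with \<open>e > 0\<close> r(1) show ?thesis by (intro exI[of _ "min e r"]) auto
  qed
  have sub_ball: "\<exists>e>0. hattori_nbhd A x e \<subseteq> mball x r" if "r > 0" for x r
  proof -
    \<comment> \<open>A basic neighbourhood of \<open>x\<close> is a Euclidean ball cut down to
      \<open>S\<close>, so continuity of \<open>f\<close> at \<open>x\<close> within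
      \<open>S\<close> suffices.\<close>
    define S where "S = (if x \<in> A then UNIV else {x..})"
    have "eventually (\<lambda>y. dist (f y) (f x) < r) (at x within S)"
      by (rule tendstoD[OF tendsto \<open>r > 0\<close>]) (simp add: S_def)
    then obtain e where e: "e > 0" "\<And>y. y \<in> S \<Longrightarrow> y \<noteq> x \<Longrightarrow> dist y x < e \<Longrightarrow> dist (f y) (f x) < r"
      unfolding eventually_at by blast
    have "d x y < r" if "y \<in> hattori_nbhd A x e" for y
    proof (cases "y = x")
      case False
      have "y \<in> S" "dist y x < e"
        using that by (auto simp: S_def hattori_nbhd_def dist_real_def split: if_splits)
      then have "dist (f y) (f x) < r"
        using e(2) False by blast
      then show ?thesis
        by (simp add: d_def dist_real_def abs_minus_commute)
    qed (simp add: d_def \<open>r > 0\<close>)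
    with e(1) show ?thesis by auto
  qed
  have "hattori_topology A = mtopology"
    unfolding topology_eq openin_hattori openin_mtopology
  proof (intro allI iffI conjI ballI impI)
    fix U x
    assume U: "\<forall>x\<in>U. \<exists>e>0. hattori_nbhd A x e \<subseteq> U" and "x \<in> U"
    then obtain e where "e > 0" "hattori_nbhd A x e \<subseteq> U" by blast
    then show "\<exists>r>0. mball x r \<subseteq> U"
      using sub_nbhd[of e x] by blast
  next
    fix U x
    assume "U \<subseteq> UNIV \<and> (\<forall>x. x \<in> U \<longrightarrow> (\<exists>r>0. mball x r \<subseteq> U))" and "x \<in> U"
    then obtain r where "r > 0" "mball x r \<subseteq> U" by blast
    then show "\<exists>e>0. hattori_nbhd A x e \<subseteq> U"
      using sub_ball[of r x] by blast
  qed simp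
  then show ?thesis
    using metrizable_space_mtopology by simp
qed

theorem theorem3p25:
  fixes A :: "real set"
  shows "(metrizable_space (hattori_topology A) \<longleftrightarrow> beta_space (hattori_topology A)) \<and>
         (beta_space (hattori_topology A) \<longleftrightarrow> countable (UNIV - A))"
  using metrizable_imp_beta_space beta_hattori_imp_countable countable_imp_metrizable_hattori
  by blast

end
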